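(* Let $\mathbf{R}\in\mathbb{R}^{d\times d}$ be a symmetric positive semi-definite matrix with $\lambda_1(\mathbf{R})>\lambda_d(\mathbf{R})$ and with all diagonal entries positive, let $1<\kappa_{max}<\kappa(\mathbf{R})$ with $\kappa_{max}$ finite, and let $\mathbf{R}_{RR}=\mathbf{R}+\delta\mathbf{I}_d$ be the ridge regression reconditioned matrix, where $$\delta=\frac{\lambda_1(\mathbf{R})-\lambda_d(\mathbf{R})\kappa_{max}}{\kappa_{max}-1}.$$ Let $\mathbf{C}$ and $\mathbf{C}_{RR}$ be the correlation matrices of $\mathbf{R}$ and $\mathbf{R}_{RR}$ respectively. Then for all $i\ne j$, $$|\mathbf{C}_{RR}(i,j)|<|\mathbf{C}(i,j)|.$$
   Context: Eigenvalues of a symmetric positive semi-definite matrix $\mathbf{S}\in\mathbb{R}^{d\times d}$ are ordered $\lambda_1(\mathbf{S})\ge\dots\ge\lambda_d(\mathbf{S})\ge 0$. The condition number is $\kappa(\mathbf{S})=\lambda_1(\mathbf{S})/\lambda_d(\mathbf{S})$ if $\mathbf{S}$ is positive definite, and $\kappa(\mathbf{S})=\infty$ if $\mathbf{S}$ is singular. The correlation matrix of a symmetric positive semi-definite $\mathbf{S}$ with positive diagonal entries is the matrix with $(i,j)$ entry $\dfrac{\mathbf{S}(i,j)}{\sqrt{\mathbf{S}(i,i)}\sqrt{\mathbf{S}(j,j)}}$. $\mathbf{I}_d$ is the $d\times d$ identity matrix.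
   Formalization: The strict inequality is proved for all i ≠ j with C(i,j) ≠ 0; if C(i,j) = 0 then C_RR(i,j) = 0 too and the printed strict inequality fails (e.g. R = diag(2,1), κ_max = 3/2). *)

theory Defs
  imports
    "HOL-Library.Extended_Real"
    "HOL-Library.Multiset"
    "HOL-Computational_Algebra.Fundamental_Theorem_Algebra"
    "Jordan_Normal_Form.Char_Poly"
begin

(* Matrix entries are indexed from 0: the entry (i, j) of a d x d matrix is
   S $$ (i, j) with i, j < d. Eigenvalues are indexed from 1. *)

definition symmetric_mat :: "real mat \<Rightarrow> bool" where
  "symmetric_mat S \<longleftrightarrow> square_mat S \<and> transpose_mat S = S"

definition pos_semidef :: "real mat \<Rightarrow> bool" where
  "pos_semidef S \<longleftrightarrow> symmetric_mat S \<and>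
     (\<forall>v \<in> carrier_vec (dim_row S). 0 \<le> v \<bullet> (S *\<^sub>v v))"

definition pos_def :: "real mat \<Rightarrow> bool" where
  "pos_def S \<longleftrightarrow> symmetric_mat S \<and>
     (\<forall>v \<in> carrier_vec (dim_row S). v \<noteq> 0\<^sub>v (dim_row S) \<longrightarrow> 0 < v \<bullet> (S *\<^sub>v v))"

(* nth_eigval S k is the k-th largest eigenvalue, counted with multiplicity,
   for 1 \<le> k \<le> d. It is meant for symmetric S, whose characteristic polynomial
   has all its d roots in the reals. *)
definition nth_eigval :: "real mat \<Rightarrow> nat \<Rightarrow> real" where
  "nth_eigval S k = rev (sorted_list_of_multiset (proots (char_poly S))) ! (k - 1)"

(* Meant for positive semi-definite S, for which failing to be positive definite
   is the same as being singular. *)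
definition cond_number :: "real mat \<Rightarrow> ereal" where
  "cond_number S =
     (if pos_def S then ereal (nth_eigval S 1 / nth_eigval S (dim_row S)) else \<infinity>)"

definition correlation_mat :: "real mat \<Rightarrow> real mat" where
  "correlation_mat S = mat (dim_row S) (dim_col S)
     (\<lambda>(i, j). S $$ (i, j) / (sqrt (S $$ (i, i)) * sqrt (S $$ (j, j))))"

definition ridge_delta :: "real mat \<Rightarrow> real \<Rightarrow> real" where
  "ridge_delta R \<kappa>max =
     (nth_eigval R 1 - nth_eigval R (dim_row R) * \<kappa>max) / (\<kappa>max - 1)"

definition ridge_mat :: "real mat \<Rightarrow> real \<Rightarrow> real mat" where
  "ridge_mat R \<kappa>max = R + ridge_delta R \<kappa>max \<cdot>\<^sub>m 1\<^sub>m (dim_row R)"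

end

theory Submission
  imports Defs
begin

text \<open>
  Adding \<open>\<delta> I\<close> to \<open>R\<close> leaves the off-diagonal entries alone and replaces each
  variance \<open>R(i,i)\<close> by \<open>R(i,i) + \<delta>\<close>. For \<open>\<delta> > 0\<close> the denominators of all
  correlations grow strictly, so every nonzero off-diagonal correlation shrinks strictly
  (\<open>abs_correlation_mat_add_scalar_less\<close>). It remains to see that the ridge parameter is
  positive, that is, \<open>\<lambda>\<^sub>d \<kappa>max < \<lambda>\<^sub>1\<close> (\<open>ridge_delta_pos\<close>).

  If \<open>\<lambda>\<^sub>d \<le> 0\<close>, this follows from \<open>\<lambda>\<^sub>d < \<lambda>\<^sub>1\<close> and \<open>\<kappa>max > 1\<close>. If \<open>\<lambda>\<^sub>d > 0\<close> and \<open>R\<close> is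
  positive definite, it is the bound \<open>\<kappa>max < \<lambda>\<^sub>1 / \<lambda>\<^sub>d\<close>. What has to be excluded is a
  matrix with \<open>\<lambda>\<^sub>d > 0\<close> that is positive semi-definite but not definite: its condition
  number is infinite and bounds nothing. Such a matrix has \<open>0\<close> as a root of its
  characteristic polynomial (\<open>pos_semidef_singular_root\<close>), and \<open>\<lambda>\<^sub>d\<close> is at most any root
  (\<open>last_nth_eigval_le_root\<close>). The last fact rests on the reality of the spectrum of a
  symmetric matrix: only when all \<open>d\<close> complex roots are real does the sorted list of real
  roots have a \<open>d\<close>-th entry, which is then its minimum.
\<close>

section \<open>Spectra of symmetric matrices\<close>

lemma symmetric_mat_bilinear_swap:
  assumes S: "S \<in> carrier_mat d d" and sym: "symmetric_mat S"
    and x: "x \<in> carrier_vec d" and y: "y \<in> carrier_vec d"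
  shows "x \<bullet> (S *\<^sub>v y) = y \<bullet> (S *\<^sub>v x)"
proof -
  have T: "transpose_mat S = S" using sym unfolding symmetric_mat_def by simp
  have "x \<bullet> (S *\<^sub>v y) = (S *\<^sub>v y) \<bullet> x"
    using S x y by (intro comm_scalar_prod) auto
  also have "\<dots> = (transpose_mat S *\<^sub>v y) \<bullet> x"
    by (simp only: T)
  also have "\<dots> = y \<bullet> (S *\<^sub>v x)"
    using transpose_vec_mult_scalar[OF S x y] .
  finally show ?thesis .
qed

text \<open>
  Split an eigenvector of \<open>z\<close> into real and imaginary parts, \<open>v = x + \<i> y\<close>, so that
  \<open>S x = Re z x - Im z y\<close> and \<open>S y = Re z y + Im z x\<close>. Then \<open>x \<bullet> S y = y \<bullet> S x\<close>
  reads \<open>Im z (x \<bullet> x + y \<bullet> y) = 0\<close>, and \<open>v \<noteq> 0\<close> forces \<open>Im z = 0\<close>.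
\<close>
lemma symmetric_mat_eigenvalue_real:
  assumes S: "S \<in> carrier_mat d d" and sym: "symmetric_mat S"
    and root: "poly (map_poly complex_of_real (char_poly S)) z = 0"
  shows "z \<in> \<real>"
proof -
  let ?M = "map_mat complex_of_real S"
  have M: "?M \<in> carrier_mat d d" using S by simp
  have "char_poly ?M = map_poly complex_of_real (char_poly S)"
    by (rule of_real_hom.char_poly_hom[OF S])
  then have "poly (char_poly ?M) z = 0" using root by simp
  then obtain v where v: "v \<in> carrier_vec d" "v \<noteq> 0\<^sub>v d" "?M *\<^sub>v v = z \<cdot>\<^sub>v v"
    using eigenvalue_root_char_poly[OF M] M
    unfolding eigenvalue_def eigenvector_def by auto
  define x where "x = map_vec Re v"
  define y where "y = map_vec Im v"
  have xy: "x \<in> carrier_vec d" "y \<in> carrier_vec d"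
    using v unfolding x_def y_def by auto
  have entry: "(\<Sum>j<d. complex_of_real (S $$ (i, j)) * v $ j) = z * v $ i" if "i < d" for i
  proof -
    have "(\<Sum>j<d. complex_of_real (S $$ (i, j)) * v $ j) = (?M *\<^sub>v v) $ i"
      using that S v(1) by (auto simp: scalar_prod_def lessThan_atLeast0)
    also have "\<dots> = z * v $ i" unfolding v(3) using v(1) that by simp
    finally show ?thesis .
  qed
  have Sx: "S *\<^sub>v x = Re z \<cdot>\<^sub>v x - Im z \<cdot>\<^sub>v y"
  proof (rule eq_vecI)
    fix i assume "i < dim_vec (Re z \<cdot>\<^sub>v x - Im z \<cdot>\<^sub>v y)"
    then have i: "i < d" using xy by simp
    have "(\<Sum>j<d. S $$ (i, j) * Re (v $ j)) = Re z * Re (v $ i) - Im z * Im (v $ i)"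
      using arg_cong[OF entry[OF i], of Re] by simp
    then show "(S *\<^sub>v x) $ i = (Re z \<cdot>\<^sub>v x - Im z \<cdot>\<^sub>v y) $ i"
      using i S v by (auto simp: scalar_prod_def lessThan_atLeast0 x_def y_def)
  qed (use S xy in auto)
  have Sy: "S *\<^sub>v y = Re z \<cdot>\<^sub>v y + Im z \<cdot>\<^sub>v x"
  proof (rule eq_vecI)
    fix i assume "i < dim_vec (Re z \<cdot>\<^sub>v y + Im z \<cdot>\<^sub>v x)"
    then have i: "i < d" using xy by simp
    have "(\<Sum>j<d. S $$ (i, j) * Im (v $ j)) = Re z * Im (v $ i) + Im z * Re (v $ i)"
      using arg_cong[OF entry[OF i], of Im] by simp
    then show "(S *\<^sub>v y) $ i = (Re z \<cdot>\<^sub>v y + Im z \<cdot>\<^sub>v x) $ i"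
      using i S v by (auto simp: scalar_prod_def lessThan_atLeast0 x_def y_def)
  qed (use S xy in auto)
  have "y \<bullet> (S *\<^sub>v x) = Re z * (y \<bullet> x) - Im z * (y \<bullet> y)"
    unfolding Sx using xy by (simp add: scalar_prod_minus_distrib)
  moreover have "x \<bullet> (S *\<^sub>v y) = Re z * (x \<bullet> y) + Im z * (x \<bullet> x)"
    unfolding Sy using xy by (simp add: scalar_prod_add_distrib)
  ultimately have "Im z * (x \<bullet> x + y \<bullet> y) = 0"
    using symmetric_mat_bilinear_swap[OF S sym xy] comm_scalar_prod[OF xy]
    by (simp add: algebra_simps)
  moreover have "x \<bullet> x + y \<bullet> y \<noteq> 0"
  proof
    assume "x \<bullet> x + y \<bullet> y = 0"
    then have "x \<bullet> x = 0" "y \<bullet> y = 0"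
      using conjugate_square_ge_0_vec[of x] conjugate_square_ge_0_vec[of y] by auto
    then have "x = 0\<^sub>v d" "y = 0\<^sub>v d"
      using conjugate_square_eq_0_vec[OF xy(1)] conjugate_square_eq_0_vec[OF xy(2)] by auto
    have "v = 0\<^sub>v d"
    proof (rule eq_vecI)
      fix i assume "i < dim_vec (0\<^sub>v d :: complex vec)"
      then have i: "i < d" by simp
      have "x $ i = 0" "y $ i = 0"
        using \<open>x = 0\<^sub>v d\<close> \<open>y = 0\<^sub>v d\<close> i by auto
      then show "v $ i = 0\<^sub>v d $ i"
        using i v(1) unfolding x_def y_def by (auto simp: complex_eq_iff)
    qed (use v in auto)
    with v show False by simp
  qed
  ultimately show ?thesis by (simp add: complex_is_Real_iff)
qed

text \<open>
  By the fundamental theorem of algebra a nonconstant real polynomial has a complex root;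
  here that root is real, so a real linear factor splits off and the quotient inherits the
  hypothesis.
\<close>
lemma size_proots_real_rooted:
  fixes p :: "real poly"
  assumes "p \<noteq> 0" and "\<And>z. poly (map_poly complex_of_real p) z = 0 \<Longrightarrow> z \<in> \<real>"
  shows "size (proots p) = degree p"
  using assms
proof (induction "degree p" arbitrary: p)
  case 0
  then show ?case using size_proots_le[of p] by simp
next
  case (Suc n)
  interpret emb: map_poly_comm_ring_hom complex_of_real ..
  have "degree (map_poly complex_of_real p) > 0"
    using Suc.hyps(2) by simp
  then obtain z where z: "poly (map_poly complex_of_real p) z = 0"
    using alg_closed_imp_poly_has_root by blast
  with Suc.prems(2) obtain r where r: "z = complex_of_real r"
    by (auto elim: Reals_cases)
  have "poly p r = 0" using z unfolding r by simp
  then obtain q where q: "p = [:- r, 1:] * q"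
    by (auto simp: poly_eq_0_iff_dvd)
  have q0: "q \<noteq> 0" using Suc.prems(1) q by auto
  have lin0: "[:- r, 1:] \<noteq> 0" by simp
  have "degree p = Suc (degree q)"
    unfolding q using q0 by (subst degree_mult_eq) auto
  moreover have "z \<in> \<real>" if "poly (map_poly complex_of_real q) z = 0" for z
  proof (rule Suc.prems(2))
    have "map_poly complex_of_real p
        = map_poly complex_of_real [:- r, 1:] * map_poly complex_of_real q"
      unfolding q by (rule emb.hom_mult)
    then show "poly (map_poly complex_of_real p) z = 0" using that by simp
  qed
  ultimately have "size (proots q) = degree q"
    using Suc.hyps q0 by auto
  then show ?case
    using \<open>degree p = Suc (degree q)\<close> proots_mult[OF lin0 q0] q by simp
qed

text \<open>
  The ordered list of eigenvalues consists of the real roots, so its \<open>d\<close>-th entry is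
  meaningful only because all \<open>d\<close> roots are real; it is then the least one.
\<close>
lemma last_nth_eigval_le_root:
  assumes S: "S \<in> carrier_mat d d" and sym: "symmetric_mat S"
    and root: "poly (char_poly S) r = 0"
  shows "nth_eigval S d \<le> r"
proof -
  let ?xs = "sorted_list_of_multiset (proots (char_poly S))"
  have deg: "degree (char_poly S) = d" and nz: "char_poly S \<noteq> 0"
    using degree_monic_char_poly[OF S] by auto
  have "size (proots (char_poly S)) = d"
    using size_proots_real_rooted[OF nz] symmetric_mat_eigenvalue_real[OF S sym] deg by simp
  then have len: "length ?xs = d"
    by (metis mset_sorted_list_of_multiset size_mset)
  have "r \<in> set ?xs"
    using root nz by (metis mem_Collect_eq set_count_proots set_sorted_list_of_multiset)
  then obtain k where k: "k < d" "?xs ! k = r"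
    using len unfolding in_set_conv_nth by auto
  have "nth_eigval S d = ?xs ! 0"
    unfolding nth_eigval_def using k len by (simp add: rev_nth)
  also have "\<dots> \<le> ?xs ! k"
    using k len by (intro sorted_nth_mono) auto
  finally show ?thesis using k by simp
qed

section \<open>Singularity of semi-definite matrices that are not definite\<close>

text \<open>
  A vector at which the form \<open>u \<bullet> S u\<close> vanishes minimizes it, so the gradient \<open>2 S v\<close>
  must vanish there. Concretely, a short step from \<open>v\<close> in the direction \<open>- S v\<close> would
  make the form negative unless \<open>S v = 0\<close>.
\<close>
lemma pos_semidef_isotropic_in_kernel:
  assumes S: "S \<in> carrier_mat d d" and psd: "pos_semidef S"
    and v: "v \<in> carrier_vec d" and iso: "v \<bullet> (S *\<^sub>v v) = 0"
  shows "S *\<^sub>v v = 0\<^sub>v d"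
proof -
  define w where "w = S *\<^sub>v v"
  define a where "a = w \<bullet> w"
  define b where "b = w \<bullet> (S *\<^sub>v w)"
  have w: "w \<in> carrier_vec d" using S v unfolding w_def by simp
  have sym: "symmetric_mat S" using psd unfolding pos_semidef_def by simp
  have nonneg: "0 \<le> u \<bullet> (S *\<^sub>v u)" if "u \<in> carrier_vec d" for u
    using psd S that unfolding pos_semidef_def by auto
  have b: "b \<ge> 0" using nonneg[OF w] unfolding b_def .
  have vSw: "v \<bullet> (S *\<^sub>v w) = a"
    using symmetric_mat_bilinear_swap[OF S sym v w] unfolding a_def w_def by simp
  \<comment> \<open>The form at \<open>v - t w\<close> is \<open>t (t b - 2 a)\<close>. This step length keeps \<open>t b \<le> a\<close>,
    and \<open>b + 1\<close> avoids division by zero when \<open>b = 0\<close>.\<close>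
  define t where "t = a / (b + 1)"
  have a_eq: "a = t * (b + 1)" using b unfolding t_def by simp
  have Su: "S *\<^sub>v (v - t \<cdot>\<^sub>v w) = w - t \<cdot>\<^sub>v (S *\<^sub>v w)"
    using S v w by (simp add: mult_minus_distrib_mat_vec mult_mat_vec w_def)
  have Sw: "S *\<^sub>v w \<in> carrier_vec d" using S w by simp
  have vw: "v \<bullet> w = 0" using iso unfolding w_def .
  have "0 \<le> (v - t \<cdot>\<^sub>v w) \<bullet> (w - t \<cdot>\<^sub>v (S *\<^sub>v w))"
    using nonneg[of "v - t \<cdot>\<^sub>v w"] v w unfolding Su by simp
  also have "\<dots> = v \<bullet> w - t * (v \<bullet> (S *\<^sub>v w)) - t * (w \<bullet> w - t * (w \<bullet> (S *\<^sub>v w)))"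
    using v w Sw
    by (simp add: minus_scalar_prod_distrib[of _ d] scalar_prod_minus_distrib[of _ d] algebra_simps)
  also have "\<dots> = t * (t * b - 2 * a)"
    unfolding vw vSw by (simp add: a_def b_def algebra_simps)
  also have "\<dots> = - (t\<^sup>2 * (b + 2))"
    unfolding a_eq by (simp add: algebra_simps power2_eq_square)
  finally have "t = 0"
    using b by (auto simp: mult_le_0_iff)
  then have "a = 0" using a_eq by simp
  then show ?thesis
    using conjugate_square_eq_0_vec[OF w] unfolding a_def w_def by simp
qed

lemma pos_semidef_singular_root:
  assumes S: "S \<in> carrier_mat d d" and psd: "pos_semidef S" and "\<not> pos_def S"
  shows "poly (char_poly S) 0 = 0"
proof -
  obtain v where v: "v \<in> carrier_vec d" "v \<noteq> 0\<^sub>v d" "v \<bullet> (S *\<^sub>v v) \<le> 0"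
    using assms unfolding pos_def_def pos_semidef_def by (auto simp: not_less)
  moreover have "0 \<le> v \<bullet> (S *\<^sub>v v)"
    using psd S v unfolding pos_semidef_def by auto
  ultimately have "S *\<^sub>v v = 0\<^sub>v d"
    using pos_semidef_isotropic_in_kernel[OF S psd] by simp
  then have "eigenvector S v 0"
    using v S unfolding eigenvector_def by auto
  then show ?thesis
    using eigenvalue_root_char_poly[OF S] unfolding eigenvalue_def by blast
qed

section \<open>The effect of a ridge on correlations\<close>

lemma ridge_delta_pos:
  assumes R: "R \<in> carrier_mat d d" and psd: "pos_semidef R"
    and gap: "nth_eigval R 1 > nth_eigval R d"
    and k: "1 < \<kappa>max" "ereal \<kappa>max < cond_number R"
  shows "0 < ridge_delta R \<kappa>max"
proof -
  let ?a = "nth_eigval R 1" and ?b = "nth_eigval R d"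
  have dim: "dim_row R = d" using R by simp
  have "?b * \<kappa>max < ?a"
  proof (cases "?b \<le> 0")
    case True
    then have "?b * \<kappa>max \<le> ?b * 1" using k(1) by (intro mult_left_mono_neg) auto
    then show ?thesis using gap by simp
  next
    case False
    have "pos_def R"
    proof (rule ccontr)
      assume "\<not> pos_def R"
      then have "?b \<le> 0"
        using last_nth_eigval_le_root[OF R] pos_semidef_singular_root[OF R psd] psd
        unfolding pos_semidef_def by blast
      with False show False by simp
    qed
    then have "\<kappa>max < ?a / ?b" using k(2) dim unfolding cond_number_def by simp
    then show ?thesis using False by (simp add: field_simps)
  qed
  then show ?thesis using k(1) dim unfolding ridge_delta_def by simp
qed

lemma abs_correlation_mat_add_scalar_less:
  assumes R: "R \<in> carrier_mat d d" and diag: "\<forall>i<d. R $$ (i, i) > 0" and "0 < \<delta>"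
    and ij: "i < d" "j < d" "i \<noteq> j" and nz: "R $$ (i, j) \<noteq> 0"
  shows "\<bar>correlation_mat (R + \<delta> \<cdot>\<^sub>m 1\<^sub>m d) $$ (i, j)\<bar> < \<bar>correlation_mat R $$ (i, j)\<bar>"
proof -
  let ?a = "R $$ (i, i)" and ?b = "R $$ (j, j)"
  have pos: "0 < ?a" "0 < ?b" using diag ij by auto
  have less: "sqrt ?a * sqrt ?b < sqrt (?a + \<delta>) * sqrt (?b + \<delta>)"
    using pos \<open>0 < \<delta>\<close> by (intro mult_strict_mono) auto
  have "0 < sqrt ?a * sqrt ?b" using pos by simp
  then have "\<bar>R $$ (i, j)\<bar> / (sqrt (?a + \<delta>) * sqrt (?b + \<delta>)) < \<bar>R $$ (i, j)\<bar> / (sqrt ?a * sqrt ?b)"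
    using less nz pos \<open>0 < \<delta>\<close> by (intro divide_strict_left_mono) auto
  then show ?thesis
    using R ij pos \<open>0 < \<delta>\<close> unfolding correlation_mat_def
    by (simp add: abs_mult)
qed

theorem corollary1:
  fixes R :: "real mat" and d :: nat and \<kappa>max :: real
  assumes "R \<in> carrier_mat d d"
    and "pos_semidef R"
    and "nth_eigval R 1 > nth_eigval R d"
    and "\<forall>i<d. R $$ (i, i) > 0"
    and "1 < \<kappa>max"
    and "ereal \<kappa>max < cond_number R"
  shows "\<forall>i<d. \<forall>j<d. i \<noteq> j \<longrightarrow> correlation_mat R $$ (i, j) \<noteq> 0 \<longrightarrow>
    \<bar>correlation_mat (ridge_mat R \<kappa>max) $$ (i, j)\<bar> < \<bar>correlation_mat R $$ (i, j)\<bar>"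
proof (intro allI impI)
  fix i j assume ij: "i < d" "j < d" "i \<noteq> j" and "correlation_mat R $$ (i, j) \<noteq> 0"
  then have "R $$ (i, j) \<noteq> 0"
    using assms(1) unfolding correlation_mat_def by auto
  moreover have "0 < ridge_delta R \<kappa>max"
    using ridge_delta_pos assms by blast
  ultimately show "\<bar>correlation_mat (ridge_mat R \<kappa>max) $$ (i, j)\<bar> < \<bar>correlation_mat R $$ (i, j)\<bar>"
    using abs_correlation_mat_add_scalar_less[OF assms(1,4)] ij assms(1)
    unfolding ridge_mat_def by auto
qed

end
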